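(* For every $\tau\in\mathcal{H}$ the following equalities hold: \[\theta\big[{\textstyle{0 \atop 1/2}}\big]'(\tau,0)=-\pi\,\theta\big[{\textstyle{0 \atop 1/2}}\big](\tau,0)\Big(\theta\big[{\textstyle{0 \atop 0}}\big]^{2}(\tau,0)-\theta\big[{\textstyle{0 \atop 0}}\big]^{2}(2\tau,0)\Big)=-\pi\,\theta\big[{\textstyle{0 \atop 1/2}}\big](\tau,0)\,\theta\big[{\textstyle{1 \atop 0}}\big]^{2}(2\tau,0),\] \[\theta\big[{\textstyle{1/2 \atop 1}}\big]'(\tau,0)=\tfrac{\pi i}{2}\theta\big[{\textstyle{1/2 \atop 1}}\big](\tau,0)\,\theta\big[{\textstyle{0 \atop 0}}\big]^{2}\big(\tfrac{\tau}{2},0\big)=\tfrac{\pi i}{2}\theta\big[{\textstyle{1/2 \atop 1}}\big](\tau,0)\Big(\theta\big[{\textstyle{0 \atop 0}}\big]^{2}(\tau,0)+\theta\big[{\textstyle{1 \atop 0}}\big]^{2}(\tau,0)\Big),\] \[\theta\big[{\textstyle{1/2 \atop 0}}\big]'(\tau,0)=\tfrac{\pi i}{2}\theta\big[{\textstyle{1/2 \atop 0}}\big](\tau,0)\Big(\theta\big[{\textstyle{0 \atop 0}}\big]^{2}(\tau,0)-\theta\big[{\textstyle{1 \atop 0}}\big]^{2}(\tau,0)\Big),\] \[\theta\big[{\textstyle{1/2 \atop 1/2}}\big]'(\tau,0)=\tfrac{\pi i}{2}\theta\big[{\textstyle{1/2 \atop 1/2}}\big](\tau,0)\Big(\theta\big[{\textstyle{0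 \atop 0}}\big]^{2}(2\tau,0)-\theta\big[{\textstyle{1 \atop 0}}\big]^{2}(2\tau,0)+i\,\theta\big[{\textstyle{1 \atop 0}}\big]^{2}(\tau,0)\Big),\] \[\theta\big[{\textstyle{1/2 \atop 3/2}}\big]'(\tau,0)=\tfrac{\pi i}{2}\theta\big[{\textstyle{1/2 \atop 3/2}}\big](\tau,0)\Big(\theta\big[{\textstyle{0 \atop 0}}\big]^{2}(2\tau,0)-\theta\big[{\textstyle{1 \atop 0}}\big]^{2}(2\tau,0)-i\,\theta\big[{\textstyle{1 \atop 0}}\big]^{2}(\tau,0)\Big).\]
   Context: $\mathcal{H}$ is the upper half-plane and $\mathbf{e}(u)=e^{2\pi iu}$. For real $\varepsilon,\delta$, $\tau\in\mathcal{H}$ and $z\in\mathbb{C}$, the theta function with characteristics is \[\theta\big[{\textstyle{\varepsilon \atop \delta}}\big](\tau,z)=\sum_{n=-\infty}^{\infty}\mathbf{e}\Big[\big(n+\tfrac{\varepsilon}{2}\big)^{2}\tfrac{\tau}{2}+\big(n+\tfrac{\varepsilon}{2}\big)\big(z+\tfrac{\delta}{2}\big)\Big].\] The prime denotes differentiation with respect to $z$ only, so $\theta\big[{\varepsilon \atop \delta}\big]'(\tau,0)$ is the $z$-derivative at $z=0$. The notation $\theta\big[{\varepsilon \atop \delta}\big]^{2}(\tau,0)$ means the square of the value $\theta\big[{\varepsilon \atop \delta}\big](\tau,0)$. *)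

theory Defs
  imports "HOL-Analysis.Analysis"
begin

definition expi :: "complex \<Rightarrow> complex" where
  "expi u = exp (2 * of_real pi * \<i> * u)"

text \<open>The bilateral series converges absolutely for \<open>Im \<tau> > 0\<close>, so the unordered sum over
  the integers is its value. Outside the upper half-plane \<open>theta\<close> carries no meaning.\<close>

definition theta :: "real \<Rightarrow> real \<Rightarrow> complex \<Rightarrow> complex \<Rightarrow> complex" where
  "theta \<epsilon> \<delta> \<tau> z =
     (\<Sum>\<^sub>\<infinity>n\<in>(UNIV :: int set).
        expi ((of_int n + of_real \<epsilon> / 2)\<^sup>2 * (\<tau> / 2)
            + (of_int n + of_real \<epsilon> / 2) * (z + of_real \<delta> / 2)))"

definition theta' :: "real \<Rightarrow> real \<Rightarrow> complex \<Rightarrow> complex \<Rightarrow> complex" where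
  "theta' \<epsilon> \<delta> \<tau> z = deriv (\<lambda>w. theta \<epsilon> \<delta> \<tau> w) z"

end

theory Submission
  imports Defs "HOL-Complex_Analysis.Cauchy_Integral_Formula"
begin

text \<open>Write \<open>\<theta>[\<epsilon>;\<delta>](\<tau>)\<close> and \<open>\<theta>'[\<epsilon>;\<delta>](\<tau>)\<close> for the values at \<open>z = 0\<close>. Splitting a theta series into even and
  odd \<open>n\<close> shows the even and odd parts in \<open>z\<close> of two of the functions in question:

  \<^item> \<open>\<theta>[0;1/2](\<tau>,z) = \<theta>[0;1](4\<tau>,2z) + \<theta>[1;1](4\<tau>,2z)\<close>, an even plus an odd function of \<open>z\<close>;
  \<^item> \<open>\<theta>[1;1](\<tau>/4,z/2) = \<i> (\<theta>[1/2;0](\<tau>,z) - \<theta>[1/2;0](\<tau>,-z))\<close>.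

  So the derivatives for \<open>[0;1/2]\<close> and \<open>[1/2;0]\<close> are multiples of \<open>\<theta>'[1;1]\<close> at the moduli \<open>4\<tau>\<close> and \<open>\<tau>/4\<close>.
  Jacobi's derivative formula \<open>\<theta>'[1;1] = -\<pi> \<theta>[0;0] \<theta>[0;1] \<theta>[1;0]\<close> turns them into
  products of theta constants, and quadratic relations between the theta constants at \<open>\<tau>\<close>
  and \<open>2\<tau>\<close> bring the products into the stated form. Replacing \<open>\<tau>\<close> by \<open>\<tau> + 1\<close> takes \<open>[1/2;\<delta>]\<close> to
  \<open>[1/2;\<delta> + 3/2]\<close> up to a constant factor, and \<open>\<delta>\<close> matters only modulo 2 up to such a factor; neither
  step affects a logarithmic derivative. In this way \<open>\<delta> = 0\<close> leads to \<open>3/2\<close>, to \<open>3 \<equiv> 1\<close> and to \<open>5/2 \<equiv> 1/2\<close>.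

  The quadratic relations follow from one product formula, \<open>theta_product\<close>, obtained by passing to
  \<open>m + n\<close> and \<open>m - n\<close> in a double series, together with the splitting and the translation above.
  The product formula also drives an elementary proof of Jacobi's formula: the quotient
  \<open>F(\<tau>) = \<theta>'[1;1] / (\<theta>[0;0] \<theta>[0;1] \<theta>[1;0])\<close> satisfies \<open>F(2\<tau>) = F(\<tau>)\<close>, hence
  \<open>F(\<tau>) = F(2\<^sup>k\<tau>)\<close> for all \<open>k\<close>, and the leading terms of the series show that the
  latter tends to \<open>-\<pi>\<close>. The denominator does not vanish: a zero of \<open>\<theta>[0;1]\<close> or \<open>\<theta>[1;0]\<close> at \<open>\<tau>\<close>
  would force zeros at all \<open>2\<^sup>k\<tau>\<close>, against their leading terms, and a zero of \<open>\<theta>[0;0]\<close>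
  would force one of \<open>\<theta>[0;1]\<close>.\<close>

section \<open>The normalised exponential\<close>

lemma expi_add: "expi (u + v) = expi u * expi v"
  by (simp add: expi_def ring_distribs exp_add)

lemma expi_minus: "expi (- u) = inverse (expi u)"
  by (simp add: expi_def exp_minus)

lemma expi_of_nat_mult: "expi (of_nat k * u) = expi u ^ k"
  unfolding expi_def exp_of_nat_mult[symmetric] by (simp add: algebra_simps)

lemma norm_expi: "norm (expi u) = exp (- (2 * pi * Im u))"
  by (simp add: expi_def)

lemma expi_nonzero [simp]: "expi u \<noteq> 0"
  by (simp add: expi_def)

lemma expi_0 [simp]: "expi 0 = 1"
  by (simp add: expi_def)

lemma expi_of_int [simp]: "expi (of_int n) = 1"
  using exp_integer_2pi[of "of_int n"] by (simp add: expi_def algebra_simps)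

lemma expi_half [simp]: "expi (1/2) = -1"
  by (simp add: expi_def)

lemma expi_quarter [simp]: "expi (1/4) = \<i>"
  using cis_pi_half by (simp add: expi_def cis_conv_exp mult_ac)

lemma expi_add_of_int [simp]: "expi (u + of_int n) = expi u"
  by (simp add: expi_add)

lemma expi_three_quarters [simp]: "expi (3/4) = - \<i>"
proof -
  have "expi (3/4) = expi (1/2 + 1/4)"
    by simp
  also have "\<dots> = - \<i>"
    by (subst expi_add) simp
  finally show ?thesis .
qed

lemma expi_cong_int:
  assumes "u = v + of_int n"
  shows "expi u = expi v"
  using assms by simp

section \<open>Convergence and termwise differentiation\<close>

definition theta_term :: "real \<Rightarrow> real \<Rightarrow> complex \<Rightarrow> complex \<Rightarrow> int \<Rightarrow> complex" where
  "theta_term \<epsilon> \<delta> \<tau> z n =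
     expi ((of_int n + of_real \<epsilon> / 2)\<^sup>2 * (\<tau> / 2)
         + (of_int n + of_real \<epsilon> / 2) * (z + of_real \<delta> / 2))"

lemma theta_eq_infsum: "theta \<epsilon> \<delta> \<tau> z = (\<Sum>\<^sub>\<infinity>n. theta_term \<epsilon> \<delta> \<tau> z n)"
  by (simp add: theta_def theta_term_def)

lemma summable_on_exp_minus_abs_int: "(\<lambda>n::int. exp (- \<bar>real_of_int n\<bar>)) summable_on UNIV"
proof -
  have *: "(\<lambda>n::nat. exp (- real n)) summable_on UNIV"
  proof -
    have "summable (\<lambda>n::nat. exp (-1::real) ^ n)"
      by (rule summable_geometric) simp
    then have "summable (\<lambda>n::nat. exp (- real n))"
      by (simp add: exp_of_nat_mult[symmetric])
    then show ?thesis
      by (subst summable_on_UNIV_nonneg_real_iff) auto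
  qed
  have "(\<lambda>n::int. exp (- \<bar>real_of_int n\<bar>)) summable_on range int"
    by (subst summable_on_reindex) (use * in \<open>auto simp: o_def\<close>)
  moreover have "(\<lambda>n::int. exp (- \<bar>real_of_int n\<bar>)) summable_on range (\<lambda>n. - int n)"
    by (subst summable_on_reindex) (use * in \<open>auto simp: o_def inj_on_def\<close>)
  moreover have "UNIV = range int \<union> range (\<lambda>n. - int n)"
    using int_cases2 by blast
  ultimately show ?thesis
    using summable_on_union by metis
qed

text \<open>Completing the square in \<open>\<bar>n + \<epsilon>/2\<bar>\<close> lets the Gaussian decay absorb the linear term.
  The bound is uniform in \<open>z\<close> on discs, as locally uniform convergence, and with it
  termwise differentiation, requires.\<close>

lemma theta_term_bound:
  assumes "Im \<tau> > 0"
  obtains C where "\<And>n z. norm z \<le> R \<Longrightarrow>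
    norm (theta_term \<epsilon> \<delta> \<tau> z n) \<le> C * exp (- \<bar>real_of_int n\<bar>)"
proof
  fix n :: int and z :: complex
  assume z: "norm z \<le> R"
  define y where "y = pi * Im \<tau>"
  define b where "b = 2 * pi * R + 1"
  define a where "a = real_of_int n + \<epsilon> / 2"
  have y: "y > 0"
    using assms by (simp add: y_def)
  have a: "(of_int n + of_real \<epsilon> / 2 :: complex) = of_real a"
    by (simp add: a_def)
  have "norm (theta_term \<epsilon> \<delta> \<tau> z n) = exp (- (y * a\<^sup>2) - 2 * pi * (a * Im z))"
    unfolding theta_term_def norm_expi a by (simp add: y_def algebra_simps flip: of_real_power)
  also have "\<dots> \<le> exp (b\<^sup>2 / (4 * y) + \<bar>\<epsilon>\<bar> / 2 - \<bar>real_of_int n\<bar>)"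
  proof -
    have "\<bar>a * Im z\<bar> \<le> \<bar>a\<bar> * R"
      using z abs_Im_le_cmod[of z] by (simp add: abs_mult mult_left_mono)
    then have "- (a * Im z) \<le> \<bar>a\<bar> * R"
      by linarith
    then have "2 * pi * (- (a * Im z)) \<le> 2 * pi * (\<bar>a\<bar> * R)"
      by (intro mult_left_mono) auto
    \<comment> \<open>The 1 in \<open>b = 2\<pi>R + 1\<close> leaves \<open>-\<bar>a\<bar>\<close> over for the decay in \<open>n\<close>.\<close>
    then have 1: "- (2 * pi * (a * Im z)) \<le> b * \<bar>a\<bar> - \<bar>a\<bar>"
      by (simp add: b_def algebra_simps)
    have "0 \<le> (2 * y * \<bar>a\<bar> - b)\<^sup>2 / (4 * y)"
      using y by simp
    also have "\<dots> = y * a\<^sup>2 - b * \<bar>a\<bar> + b\<^sup>2 / (4 * y)"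
      using y by (simp add: field_simps power2_eq_square)
    finally have 2: "b * \<bar>a\<bar> - y * a\<^sup>2 \<le> b\<^sup>2 / (4 * y)"
      by simp
    have "\<bar>real_of_int n\<bar> \<le> \<bar>a\<bar> + \<bar>\<epsilon>\<bar> / 2"
      unfolding a_def by linarith
    with 1 2 show ?thesis
      by simp
  qed
  also have "\<dots> = exp (b\<^sup>2 / (4 * y) + \<bar>\<epsilon>\<bar> / 2) * exp (- \<bar>real_of_int n\<bar>)"
    by (simp flip: exp_add)
  finally show "norm (theta_term \<epsilon> \<delta> \<tau> z n)
      \<le> exp ((2 * pi * R + 1)\<^sup>2 / (4 * (pi * Im \<tau>)) + \<bar>\<epsilon>\<bar> / 2) * exp (- \<bar>real_of_int n\<bar>)"
    by (simp add: y_def b_def)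
qed

lemma theta_term_summable:
  assumes "Im \<tau> > 0"
  shows "theta_term \<epsilon> \<delta> \<tau> z summable_on UNIV"
proof -
  obtain C where C: "\<And>n w. norm w \<le> norm z \<Longrightarrow>
      norm (theta_term \<epsilon> \<delta> \<tau> w n) \<le> C * exp (- \<bar>real_of_int n\<bar>)"
    using theta_term_bound[OF assms] by metis
  have "(\<lambda>n. norm (theta_term \<epsilon> \<delta> \<tau> z n)) summable_on UNIV"
    by (rule Infinite_Sum.abs_summable_on_comparison_test'
        [OF summable_on_cmult_right[OF summable_on_exp_minus_abs_int] C]) auto
  then show ?thesis
    by (rule Infinite_Sum.abs_summable_summable)
qed

lemma theta_term_has_sum:
  assumes "Im \<tau> > 0"
  shows "(theta_term \<epsilon> \<delta> \<tau> z has_sum theta \<epsilon> \<delta> \<tau> z) UNIV"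
  unfolding theta_eq_infsum using theta_term_summable[OF assms] by (rule has_sum_infsum)

text \<open>The partial sums over finite sets of integers converge uniformly on a disc by the
  Weierstrass test, and uniform limits of holomorphic functions may be differentiated termwise. The
  second part is needed for the limit of \<open>theta' 1 1\<close> towards the cusp.\<close>

lemma theta_has_field_derivative:
  assumes "Im \<tau> > 0"
  shows "(theta \<epsilon> \<delta> \<tau> has_field_derivative theta' \<epsilon> \<delta> \<tau> z) (at z)"
    and "((\<lambda>n. 2 * of_real pi * \<i> * (of_int n + of_real \<epsilon> / 2) * theta_term \<epsilon> \<delta> \<tau> z n)
           has_sum theta' \<epsilon> \<delta> \<tau> z) UNIV"
proof -
  define R where "R = norm z + 1"
  define d where
    "d w n = 2 * of_real pi * \<i> * (of_int n + of_real \<epsilon> / 2) * theta_term \<epsilon> \<delta> \<tau> w n" for w n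
  obtain C where C: "\<And>n w. norm w \<le> R \<Longrightarrow>
      norm (theta_term \<epsilon> \<delta> \<tau> w n) \<le> C * exp (- \<bar>real_of_int n\<bar>)"
    using theta_term_bound[OF assms] by metis
  have R: "norm w \<le> R" if "w \<in> cball z 1" for w
    using that norm_triangle_ineq2[of w z] by (simp add: R_def dist_norm norm_minus_commute)
  have ul: "uniform_limit (cball z 1) (\<lambda>X w. \<Sum>n\<in>X. theta_term \<epsilon> \<delta> \<tau> w n) (theta \<epsilon> \<delta> \<tau>)
      (finite_subsets_at_top UNIV)"
    by (rule Weierstrass_m_test_general'
        [OF C theta_term_has_sum[OF assms] summable_on_cmult_right[OF summable_on_exp_minus_abs_int]])
       (use R in auto)
  have der: "((\<lambda>w. theta_term \<epsilon> \<delta> \<tau> w n) has_field_derivative d w n) (at w)" for w n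
    unfolding theta_term_def expi_def d_def
    by (rule derivative_eq_intros refl | simp)+
  have ders: "((\<lambda>w. \<Sum>n\<in>X. theta_term \<epsilon> \<delta> \<tau> w n) has_field_derivative (\<Sum>n\<in>X. d w n)) (at w)" for w X
    by (intro DERIV_sum der)
  have cont: "continuous_on (cball z 1) (\<lambda>w. \<Sum>n\<in>X. theta_term \<epsilon> \<delta> \<tau> w n)" for X
    using ders by (intro DERIV_continuous_on) (auto intro: has_field_derivative_at_within)
  obtain g' where g': "\<And>w. w \<in> ball z 1 \<Longrightarrow> (theta \<epsilon> \<delta> \<tau> has_field_derivative g' w) (at w) \<and>
      ((\<lambda>X. \<Sum>n\<in>X. d w n) \<longlongrightarrow> g' w) (finite_subsets_at_top UNIV)"
    by (rule has_complex_derivative_uniform_limit[OF _ ul, of "\<lambda>X w. \<Sum>n\<in>X. d w n"])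
       (use ders cont in auto)
  have 1: "(theta \<epsilon> \<delta> \<tau> has_field_derivative g' z) (at z)"
    and 2: "(d z has_sum g' z) UNIV"
    using g'[of z] by (auto simp: has_sum_def)
  have "theta' \<epsilon> \<delta> \<tau> z = g' z"
    unfolding theta'_def using 1 by (rule DERIV_imp_deriv)
  with 1 2 show "(theta \<epsilon> \<delta> \<tau> has_field_derivative theta' \<epsilon> \<delta> \<tau> z) (at z)"
    and "((\<lambda>n. 2 * of_real pi * \<i> * (of_int n + of_real \<epsilon> / 2) * theta_term \<epsilon> \<delta> \<tau> z n)
           has_sum theta' \<epsilon> \<delta> \<tau> z) UNIV"
    by (auto simp: d_def[abs_def])
qed

section \<open>Symmetries, dissection and the product formula\<close>

lemma theta_add_two_left: "theta (\<epsilon> + 2) \<delta> \<tau> z = theta \<epsilon> \<delta> \<tau> z"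
proof -
  have "theta_term (\<epsilon> + 2) \<delta> \<tau> z n = theta_term \<epsilon> \<delta> \<tau> z (n + 1)" for n
    unfolding theta_term_def by (rule arg_cong[where f = expi]) (simp add: field_simps)
  then have "theta (\<epsilon> + 2) \<delta> \<tau> z = (\<Sum>\<^sub>\<infinity>n. theta_term \<epsilon> \<delta> \<tau> z (n + 1))"
    unfolding theta_eq_infsum by (rule infsum_cong)
  also have "\<dots> = theta \<epsilon> \<delta> \<tau> z"
    unfolding theta_eq_infsum
    by (rule infsum_reindex_bij_betw) (auto intro!: bij_betw_byWitness[where f' = "\<lambda>n. n - 1"])
  finally show ?thesis .
qed

lemma theta_add_two_right: "theta \<epsilon> (\<delta> + 2) \<tau> z = expi (of_real \<epsilon> / 2) * theta \<epsilon> \<delta> \<tau> z"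
proof -
  have "theta_term \<epsilon> (\<delta> + 2) \<tau> z n = expi (of_real \<epsilon> / 2) * theta_term \<epsilon> \<delta> \<tau> z n" for n
    unfolding theta_term_def expi_add[symmetric]
    by (rule expi_cong_int[of _ _ n]) (simp add: field_simps)
  then show ?thesis
    unfolding theta_eq_infsum infsum_cmult_right'[symmetric] by (rule infsum_cong)
qed

lemma theta_minus: "theta (- \<epsilon>) (- \<delta>) \<tau> z = theta \<epsilon> \<delta> \<tau> (- z)"
proof -
  have "theta_term (- \<epsilon>) (- \<delta>) \<tau> z n = theta_term \<epsilon> \<delta> \<tau> (- z) (- n)" for n
    unfolding theta_term_def
    by (rule arg_cong[where f = expi]) (simp add: field_simps power2_eq_square)
  then have "theta (- \<epsilon>) (- \<delta>) \<tau> z = (\<Sum>\<^sub>\<infinity>n. theta_term \<epsilon> \<delta> \<tau> (- z) (- n))"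
    unfolding theta_eq_infsum by (rule infsum_cong)
  also have "\<dots> = theta \<epsilon> \<delta> \<tau> (- z)"
    unfolding theta_eq_infsum
    by (rule infsum_reindex_bij_betw) (auto intro!: bij_betw_byWitness[where f' = uminus])
  finally show ?thesis .
qed

lemma theta_shift_argument: "theta \<epsilon> \<delta> \<tau> (z + of_real s / 2) = theta \<epsilon> (\<delta> + s) \<tau> z"
  unfolding theta_eq_infsum theta_term_def by (simp add: algebra_simps add_divide_distrib)

text \<open>Since \<open>n\<^sup>2 \<equiv> n\<close> modulo 2, the additional factor \<open>expi ((n + \<epsilon>/2)\<^sup>2 / 2)\<close> is a constant times
  a character of \<open>n\<close>, which only changes \<open>\<delta>\<close>.\<close>

lemma theta_translate:
  "theta \<epsilon> \<delta> (\<tau> + 1) z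
     = expi (- of_real \<epsilon> / 4 - of_real \<epsilon> ^ 2 / 8) * theta \<epsilon> (\<delta> + 1 + \<epsilon>) \<tau> z"
proof -
  have "theta_term \<epsilon> \<delta> (\<tau> + 1) z n
      = expi (- of_real \<epsilon> / 4 - of_real \<epsilon> ^ 2 / 8) * theta_term \<epsilon> (\<delta> + 1 + \<epsilon>) \<tau> z n" for n
  proof -
    obtain k where k: "n * n = n + 2 * k"
    proof
      show "n * n = n + 2 * (n * (n - 1) div 2)"
        by (simp add: algebra_simps)
    qed
    then have "(of_int n * of_int n :: complex) = of_int n + 2 * of_int k"
      by (metis (no_types) of_int_add of_int_mult of_int_numeral)
    then have k': "(of_int k :: complex) = (of_int n * of_int n - of_int n) / 2"
      by simp
    show ?thesis
      unfolding theta_term_def expi_add[symmetric]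
      by (rule expi_cong_int[of _ _ k], unfold k') (simp add: field_simps power2_eq_square)
  qed
  then show ?thesis
    unfolding theta_eq_infsum infsum_cmult_right'[symmetric] by (rule infsum_cong)
qed

text \<open>The two summands are the contributions of even and of odd \<open>n\<close>.\<close>

lemma theta_dissection:
  assumes "Im \<tau> > 0"
  shows "theta \<epsilon> \<delta> \<tau> z
       = theta (\<epsilon> / 2) (2 * \<delta>) (4 * \<tau>) (2 * z) + theta (\<epsilon> / 2 + 1) (2 * \<delta>) (4 * \<tau>) (2 * z)"
proof -
  let ?f = "theta_term \<epsilon> \<delta> \<tau> z"
  let ?A0 = "range (\<lambda>n::int. 2 * n)" and ?A1 = "range (\<lambda>n::int. 2 * n + 1)"
  have \<tau>: "Im (4 * \<tau>) > 0"
    using assms by simp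
  have 1: "?f (2 * n) = theta_term (\<epsilon> / 2) (2 * \<delta>) (4 * \<tau>) (2 * z) n" for n
    unfolding theta_term_def
    by (rule arg_cong[where f = expi]) (simp add: field_simps power2_eq_square)
  have 2: "?f (2 * n + 1) = theta_term (\<epsilon> / 2 + 1) (2 * \<delta>) (4 * \<tau>) (2 * z) n" for n
    unfolding theta_term_def
    by (rule arg_cong[where f = expi]) (simp add: field_simps power2_eq_square)
  have A0: "(?f has_sum theta (\<epsilon> / 2) (2 * \<delta>) (4 * \<tau>) (2 * z)) ?A0"
    by (subst has_sum_reindex) (use theta_term_has_sum[OF \<tau>] in \<open>auto simp: o_def 1 inj_on_def\<close>)
  have A1: "(?f has_sum theta (\<epsilon> / 2 + 1) (2 * \<delta>) (4 * \<tau>) (2 * z)) ?A1"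
    by (subst has_sum_reindex) (use theta_term_has_sum[OF \<tau>] in \<open>auto simp: o_def 2 inj_on_def\<close>)
  have disj: "?A0 \<inter> ?A1 = {}"
    by auto presburger
  have un: "?A0 \<union> ?A1 = UNIV"
    by (auto simp: image_iff) presburger
  show ?thesis
    using theta_term_has_sum[OF assms] has_sum_Un_disjoint[OF A0 A1 disj] unfolding un
    by (rule has_sum_unique)
qed

lemma has_sum_times_complex:
  fixes f :: "'a \<Rightarrow> complex" and g :: "'b \<Rightarrow> complex"
  assumes f: "(f has_sum a) A" and g: "(g has_sum b) B"
  shows "((\<lambda>(x, y). f x * g y) has_sum a * b) (A \<times> B)"
proof -
  have af: "(\<lambda>x. norm (f x)) summable_on A" and ag: "(\<lambda>y. norm (g y)) summable_on B"
    using f g summable_on_iff_abs_summable_on_complex has_sum_imp_summable by blast+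
  have "(\<lambda>p. norm ((\<lambda>(x, y). f x * g y) p)) summable_on (A \<times> B)"
    unfolding Infinite_Sum.abs_summable_on_Sigma_iff
    using af ag by (auto simp: norm_mult infsum_cmult_right' abs_mult
        intro!: summable_on_cmult_right summable_on_cmult_left infsum_nonneg)
  then have s: "(\<lambda>(x, y). f x * g y) summable_on (A \<times> B)"
    by (rule Infinite_Sum.abs_summable_summable)
  show ?thesis
    by (rule has_sum_SigmaI[OF _ _ s, of "\<lambda>x. f x * b"])
       (use f g in \<open>auto intro: has_sum_cmult_right has_sum_cmult_left\<close>)
qed

text \<open>Sum over pairs \<open>(m, n)\<close> and pass to \<open>m + n\<close> and \<open>m - n\<close>, which have equal parity. The exponents
  separate by the parallelogram identity \<open>a\<^sup>2 + b\<^sup>2 = ((a + b)\<^sup>2 + (a - b)\<^sup>2) / 2\<close>, and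
  the two parities give the two products.\<close>

lemma theta_product:
  assumes "Im \<tau> > 0"
  shows "theta \<epsilon> 0 \<tau> x * theta \<epsilon> 0 \<tau> y
       = theta \<epsilon> 0 (2 * \<tau>) (x + y) * theta 0 0 (2 * \<tau>) (x - y)
       + theta (\<epsilon> + 1) 0 (2 * \<tau>) (x + y) * theta 1 0 (2 * \<tau>) (x - y)"
proof -
  define F where "F = (\<lambda>(m, n). theta_term \<epsilon> 0 \<tau> x m * theta_term \<epsilon> 0 \<tau> y n)"
  define h0 h1 :: "int \<times> int \<Rightarrow> int \<times> int"
    where "h0 = (\<lambda>(k, l). (k + l, k - l))" and "h1 = (\<lambda>(k, l). (k + l + 1, k - l))"
  have \<tau>: "Im (2 * \<tau>) > 0"
    using assms by simp
  have F: "(F has_sum theta \<epsilon> 0 \<tau> x * theta \<epsilon> 0 \<tau> y) (UNIV \<times> UNIV)"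
    unfolding F_def by (intro has_sum_times_complex theta_term_has_sum assms)
  have 0: "F \<circ> h0 = (\<lambda>(k, l). theta_term \<epsilon> 0 (2 * \<tau>) (x + y) k * theta_term 0 0 (2 * \<tau>) (x - y) l)"
    unfolding theta_term_def F_def h0_def expi_add[symmetric]
    by (intro ext) (auto intro!: arg_cong[where f = expi] simp: field_simps power2_eq_square)
  have 1: "F \<circ> h1 = (\<lambda>(k, l). theta_term (\<epsilon> + 1) 0 (2 * \<tau>) (x + y) k * theta_term 1 0 (2 * \<tau>) (x - y) l)"
    unfolding theta_term_def F_def h1_def expi_add[symmetric]
    by (intro ext) (auto intro!: arg_cong[where f = expi] simp: field_simps power2_eq_square)
  have A0: "(F has_sum theta \<epsilon> 0 (2 * \<tau>) (x + y) * theta 0 0 (2 * \<tau>) (x - y)) (h0 ` (UNIV \<times> UNIV))"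
    by (subst has_sum_reindex, force simp: h0_def inj_on_def, unfold 0)
       (intro has_sum_times_complex theta_term_has_sum \<tau>)
  have A1: "(F has_sum theta (\<epsilon> + 1) 0 (2 * \<tau>) (x + y) * theta 1 0 (2 * \<tau>) (x - y))
      (h1 ` (UNIV \<times> UNIV))"
    by (subst has_sum_reindex, force simp: h1_def inj_on_def, unfold 1)
       (intro has_sum_times_complex theta_term_has_sum \<tau>)
  have disj: "h0 ` (UNIV \<times> UNIV) \<inter> h1 ` (UNIV \<times> UNIV) = {}"
    unfolding h0_def h1_def by auto presburger
  have un: "h0 ` (UNIV \<times> UNIV) \<union> h1 ` (UNIV \<times> UNIV) = UNIV \<times> UNIV"
  proof -
    have "(m, n) \<in> h0 ` (UNIV \<times> UNIV) \<union> h1 ` (UNIV \<times> UNIV)" for m n :: int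
    proof (cases "even (m + n)")
      case True
      then have "(m, n) = h0 ((m + n) div 2, (m - n) div 2)"
        unfolding h0_def by auto presburger+
      then show ?thesis by blast
    next
      case False
      then have "(m, n) = h1 ((m + n - 1) div 2, (m - n - 1) div 2)"
        unfolding h1_def by auto presburger+
      then show ?thesis by blast
    qed
    then show ?thesis
      by auto
  qed
  show ?thesis
    using F has_sum_Un_disjoint[OF A0 A1 disj] unfolding un by (rule has_sum_unique)
qed

section \<open>Quadratic relations between theta constants\<close>

lemma theta_00_translate: "theta 0 0 (\<tau> + 1) z = theta 0 1 \<tau> z"
  using theta_translate[of 0 0 \<tau> z] by simp

lemma theta_01_translate: "theta 0 1 (\<tau> + 1) z = theta 0 0 \<tau> z"
  using theta_translate[of 0 1 \<tau> z] theta_add_two_right[of 0 0 \<tau> z] by simp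

lemma theta_10_square_translate: "(theta 1 0 (\<tau> + 1) z)\<^sup>2 = \<i> * (theta 1 0 \<tau> z)\<^sup>2"
proof -
  have "theta 1 0 (\<tau> + 1) z = - (expi (- (3/8)) * theta 1 0 \<tau> z)"
    using theta_translate[of 1 0 \<tau> z] theta_add_two_right[of 1 0 \<tau> z] by simp
  moreover have "(expi (- (3/8)))\<^sup>2 = \<i>"
  proof -
    have "(expi (- (3/8)))\<^sup>2 = expi (- (3/8) + - (3/8))"
      unfolding expi_add power2_eq_square ..
    also have "\<dots> = inverse (expi (3/4))"
      unfolding expi_minus[symmetric] by simp
    finally show ?thesis
      by simp
  qed
  ultimately show ?thesis
    by (simp add: power_mult_distrib)
qed

lemma theta_00_square:
  assumes "Im \<tau> > 0"
  shows "(theta 0 0 \<tau> 0)\<^sup>2 = (theta 0 0 (2 * \<tau>) 0)\<^sup>2 + (theta 1 0 (2 * \<tau>) 0)\<^sup>2"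
  using theta_product[OF assms, of 0 0 0] by (simp add: power2_eq_square)

text \<open>The translate of the previous relation by \<open>\<tau> \<mapsto> \<tau> + 1\<close>: the argument \<open>2\<tau>\<close> moves by 2, which
  fixes \<open>\<theta>[0;0]\<close> and changes the sign of \<open>\<theta>[1;0]\<^sup>2\<close>.\<close>

lemma theta_01_square:
  assumes "Im \<tau> > 0"
  shows "(theta 0 1 \<tau> 0)\<^sup>2 = (theta 0 0 (2 * \<tau>) 0)\<^sup>2 - (theta 1 0 (2 * \<tau>) 0)\<^sup>2"
proof -
  have "2 * (\<tau> + 1) = 2 * \<tau> + 1 + 1"
    by simp
  then show ?thesis
    using theta_00_square[of "\<tau> + 1"] assms
    by (simp only: theta_00_translate theta_01_translate theta_10_square_translate) (simp flip: mult.assoc)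
qed

text \<open>By dissection, the factors on the left are the sum and the difference of the same two
  constants at \<open>4\<tau>\<close>.\<close>

lemma theta_00_mult_theta_01:
  assumes "Im \<tau> > 0"
  shows "theta 0 0 \<tau> 0 * theta 0 1 \<tau> 0 = (theta 0 1 (2 * \<tau>) 0)\<^sup>2"
proof -
  have "theta 0 0 \<tau> 0 = theta 0 0 (4 * \<tau>) 0 + theta 1 0 (4 * \<tau>) 0"
    using theta_dissection[OF assms, of 0 0 0] by simp
  moreover have "theta 0 1 \<tau> 0 = theta 0 0 (4 * \<tau>) 0 - theta 1 0 (4 * \<tau>) 0"
    using theta_dissection[OF assms, of 0 1 0] theta_add_two_right[of 0 0 "4 * \<tau>" 0]
      theta_add_two_right[of 1 0 "4 * \<tau>" 0] by simp
  moreover have "(theta 0 1 (2 * \<tau>) 0)\<^sup>2 = (theta 0 0 (4 * \<tau>) 0)\<^sup>2 - (theta 1 0 (4 * \<tau>) 0)\<^sup>2"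
    using theta_01_square[of "2 * \<tau>"] assms by (simp add: mult.assoc[symmetric])
  ultimately show ?thesis
    by (simp only:) (simp add: power2_eq_square algebra_simps)
qed

text \<open>The right side is the cross term in the square of the dissection
  \<open>\<theta>[0;0](\<tau>/2) = \<theta>[0;0](2\<tau>) + \<theta>[1;0](2\<tau>)\<close>.\<close>

lemma theta_00_mult_theta_10:
  assumes "Im \<tau> > 0"
  shows "2 * theta 0 0 (2 * \<tau>) 0 * theta 1 0 (2 * \<tau>) 0 = (theta 1 0 \<tau> 0)\<^sup>2"
proof -
  have half: "Im (\<tau> / 2) > 0"
    using assms by simp
  have "theta 0 0 (\<tau> / 2) 0 = theta 0 0 (2 * \<tau>) 0 + theta 1 0 (2 * \<tau>) 0"
    using theta_dissection[OF half, of 0 0 0] by simp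
  moreover have "(theta 0 0 (\<tau> / 2) 0)\<^sup>2 = (theta 0 0 \<tau> 0)\<^sup>2 + (theta 1 0 \<tau> 0)\<^sup>2"
    using theta_00_square[OF half] by simp
  ultimately show ?thesis
    using theta_00_square[OF assms] by (simp add: power2_eq_square algebra_simps)
qed

section \<open>Behaviour towards the cusp along \<open>2\<^sup>k\<tau>\<close>\<close>

lemma Im_two_power_mult:
  assumes "Im \<tau> > 0"
  shows "Im (2 ^ k * \<tau>) > 0"
proof -
  have "2 ^ k * \<tau> = of_real (2 ^ k) * \<tau>"
    by simp
  then show ?thesis
    using assms by (simp only: Im_complex_of_real times_complex.sel Re_complex_of_real) simp
qed

text \<open>A term with \<open>p n > 0\<close> is at most \<open>\<bar>q\<bar>\<^bsup>2^k - 1\<^esup>\<close> times its value at \<open>k = 0\<close>, so the part of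
  the series with \<open>p n > 0\<close> vanishes in the limit.\<close>

lemma lacunary_series_tendsto:
  fixes c :: "'a \<Rightarrow> complex" and p :: "'a \<Rightarrow> nat"
  assumes q: "norm q < 1" and summable: "(\<lambda>n. c n * q ^ p n) summable_on UNIV"
  shows "(\<lambda>k. \<Sum>\<^sub>\<infinity>n. c n * (q ^ (2 ^ k)) ^ p n) \<longlonglongrightarrow> (\<Sum>\<^sub>\<infinity>n\<in>{n. p n = 0}. c n)"
proof -
  define Z where "Z = {n. p n = 0}"
  define B where "B = (\<lambda>n. norm (c n * q ^ p n))"
  have B: "B summable_on UNIV"
    unfolding B_def by (rule summable_on_iff_abs_summable_on_complex[THEN iffD1, OF summable])
  have BZ: "B summable_on (- Z)"
    by (rule summable_on_subset_banach[OF B]) auto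
  have le: "norm (c n * (q ^ (2 ^ k)) ^ p n) \<le> norm q ^ (2 ^ k - 1) * B n" if "n \<notin> Z" for n k
  proof -
    have "p n + (2 ^ k - 1) \<le> 2 ^ k * p n"
    proof -
      obtain m j where "p n = Suc m" "2 ^ k = Suc j"
        using \<open>n \<notin> Z\<close> not0_implies_Suc[of "p n"] not0_implies_Suc[of "2 ^ k"] by (auto simp: Z_def)
      then show ?thesis by simp
    qed
    then have "norm q ^ (2 ^ k * p n) \<le> norm q ^ (p n + (2 ^ k - 1))"
      using q by (intro power_decreasing) auto
    then have "norm (c n) * norm q ^ (2 ^ k * p n) \<le> norm (c n) * (norm q ^ p n * norm q ^ (2 ^ k - 1))"
      unfolding power_add by (intro mult_left_mono) auto
    then show ?thesis
      by (simp add: B_def norm_mult norm_power mult_ac flip: power_mult)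
  qed
  have split: "norm ((\<Sum>\<^sub>\<infinity>n. c n * (q ^ (2 ^ k)) ^ p n) - (\<Sum>\<^sub>\<infinity>n\<in>Z. c n))
      \<le> norm q ^ (2 ^ k - 1) * (\<Sum>\<^sub>\<infinity>n\<in>-Z. B n)" for k
  proof -
    let ?g = "\<lambda>n. c n * (q ^ (2 ^ k)) ^ p n"
    have "(\<lambda>n. norm (?g n)) summable_on (- Z)"
      by (rule Infinite_Sum.abs_summable_on_comparison_test'
          [OF summable_on_cmult_right[OF BZ] le]) auto
    then have g: "?g summable_on (- Z)"
      by (rule Infinite_Sum.abs_summable_summable)
    have gZ: "?g summable_on Z"
    proof -
      have "(\<lambda>n. c n * q ^ p n) summable_on Z"
        by (rule summable_on_subset_banach[OF summable]) auto
      then show ?thesis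
        by (rule summable_on_cong[THEN iffD1, rotated]) (simp add: Z_def)
    qed
    have "infsum ?g (Z \<union> - Z) = infsum ?g Z + infsum ?g (- Z)"
      by (rule infsum_Un_disjoint[OF gZ g]) auto
    moreover have "infsum ?g Z = infsum c Z"
      by (rule infsum_cong) (simp add: Z_def)
    ultimately have "(\<Sum>\<^sub>\<infinity>n. ?g n) - infsum c Z = infsum ?g (- Z)"
      by simp
    moreover have "norm (infsum ?g (- Z)) \<le> norm q ^ (2 ^ k - 1) * infsum B (- Z)"
      by (rule norm_infsum_le[OF has_sum_infsum[OF g] has_sum_cmult_right[OF has_sum_infsum[OF BZ]]])
         (use le in auto)
    ultimately show ?thesis
      by simp
  qed
  have "filterlim (\<lambda>k. (2::nat) ^ k - 1) at_top sequentially"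
    by (rule filterlim_at_top_mono[OF filterlim_ident])
       (rule always_eventually, use less_exp in \<open>auto simp: less_eq_Suc_le le_diff_conv2\<close>)
  then have "(\<lambda>k. norm q ^ (2 ^ k - 1)) \<longlonglongrightarrow> 0"
    using filterlim_compose[OF LIMSEQ_power_zero[of "norm q"]] q by auto
  then have "(\<lambda>k. norm q ^ (2 ^ k - 1) * (\<Sum>\<^sub>\<infinity>n\<in>-Z. B n)) \<longlonglongrightarrow> 0"
    using tendsto_mult_left_zero by blast
  then have "(\<lambda>k. (\<Sum>\<^sub>\<infinity>n. c n * (q ^ (2 ^ k)) ^ p n) - (\<Sum>\<^sub>\<infinity>n\<in>Z. c n)) \<longlonglongrightarrow> 0"
    by (rule Lim_null_comparison[rotated]) (use split in auto)
  then show ?thesis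
    unfolding Z_def by (simp add: LIM_zero_iff)
qed

text \<open>The characteristics \<open>e = 0\<close> and \<open>e = 1\<close> are treated together: \<open>(n + e/2)\<^sup>2 = n (n + e) + e\<^sup>2/4\<close>, where
  \<open>n (n + e)\<close> is a natural number and \<open>e\<^sup>2 = e\<close>.\<close>

lemma theta_term_eq_power:
  fixes e :: nat
  assumes "e \<le> 1"
  shows "theta_term e \<delta> \<tau> 0 n = expi (of_nat e * \<tau> / 8) *
           (expi ((of_int n + of_nat e / 2) * of_real \<delta> / 2) * expi (\<tau> / 2) ^ nat (n * (n + int e)))"
proof -
  have e: "e = 0 \<or> e = 1"
    using assms by auto
  have "n * (n + int e) \<ge> 0"
    using e by (cases "n \<ge> 0") (auto simp: zero_le_mult_iff)
  then have "(of_nat (nat (n * (n + int e))) :: complex) = of_int (n * (n + int e))"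
    by (metis of_int_of_nat_eq nat_0_le)
  then have "expi (\<tau> / 2) ^ nat (n * (n + int e)) = expi (of_int (n * (n + int e)) * (\<tau> / 2))"
    by (metis expi_of_nat_mult)
  then show ?thesis
    unfolding theta_term_def
    using e by (auto simp flip: expi_add intro!: arg_cong[where f = expi]
        simp: field_simps power2_eq_square)
qed

text \<open>The weight 1 gives the theta constants, and a weight linear in \<open>n\<close> their \<open>z\<close>-derivatives. After
  division by the leading exponential, only the terms with \<open>n (n + e) = 0\<close> survive.\<close>

lemma weighted_theta_tendsto:
  fixes e :: nat
  assumes e: "e \<le> 1" and \<tau>: "Im \<tau> > 0"
    and summable: "(\<lambda>n. w n * theta_term e \<delta> \<tau> 0 n) summable_on UNIV"
  shows "(\<lambda>k. (\<Sum>\<^sub>\<infinity>n. w n * theta_term e \<delta> (2 ^ k * \<tau>) 0 n) / expi (of_nat e * (2 ^ k * \<tau>) / 8))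
    \<longlonglongrightarrow> (\<Sum>n\<in>{0, - int e}. w n * expi ((of_int n + of_nat e / 2) * of_real \<delta> / 2))"
proof -
  define c where "c n = w n * expi ((of_int n + of_nat e / 2) * of_real \<delta> / 2)" for n
  define p where "p n = nat (n * (n + int e))" for n
  have term_eq: "w n * theta_term e \<delta> \<sigma> 0 n = expi (of_nat e * \<sigma> / 8) * (c n * expi (\<sigma> / 2) ^ p n)" for n \<sigma>
    unfolding theta_term_eq_power[OF e] c_def p_def by (simp add: mult_ac)
  have q: "norm (expi (\<tau> / 2)) < 1"
    using \<tau> by (simp add: norm_expi)
  have "(\<lambda>n. c n * expi (\<tau> / 2) ^ p n) summable_on UNIV"
    using summable unfolding term_eq by (simp add: summable_on_cmult_right')
  from lacunary_series_tendsto[OF q this]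
  have "(\<lambda>k. \<Sum>\<^sub>\<infinity>n. c n * (expi (\<tau> / 2) ^ 2 ^ k) ^ p n) \<longlonglongrightarrow> infsum c {n. p n = 0}" .
  moreover have "{n. p n = 0} = {0, - int e}"
    using e by (auto simp: p_def le_Suc_eq mult_le_0_iff)
  moreover have "expi (\<tau> / 2) ^ 2 ^ k = expi (2 ^ k * \<tau> / 2)" for k
    using expi_of_nat_mult[of "2 ^ k" "\<tau> / 2"] by simp
  moreover have "(\<Sum>\<^sub>\<infinity>n. w n * theta_term e \<delta> \<sigma> 0 n) / expi (of_nat e * \<sigma> / 8)
      = (\<Sum>\<^sub>\<infinity>n. c n * expi (\<sigma> / 2) ^ p n)" for \<sigma>
    unfolding term_eq by (simp add: infsum_cmult_right')
  ultimately show ?thesis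
    by (simp add: c_def)
qed

lemma theta_0_tendsto:
  assumes "Im \<tau> > 0"
  shows "(\<lambda>k. theta 0 \<delta> (2 ^ k * \<tau>) 0) \<longlonglongrightarrow> 1"
  using weighted_theta_tendsto[of 0 \<tau> "\<lambda>_. 1" \<delta>] theta_term_summable[OF assms, of 0 \<delta> 0] assms
  by (simp add: theta_eq_infsum)

lemma theta_10_tendsto:
  assumes "Im \<tau> > 0"
  shows "(\<lambda>k. theta 1 0 (2 ^ k * \<tau>) 0 / expi (2 ^ k * \<tau> / 8)) \<longlonglongrightarrow> 2"
  using weighted_theta_tendsto[of 1 \<tau> "\<lambda>_. 1" 0] theta_term_summable[OF assms, of 1 0 0] assms
  by (simp add: theta_eq_infsum)

lemma theta'_11_tendsto:
  assumes "Im \<tau> > 0"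
  shows "(\<lambda>k. theta' 1 1 (2 ^ k * \<tau>) 0 / expi (2 ^ k * \<tau> / 8)) \<longlonglongrightarrow> - 2 * of_real pi"
proof -
  let ?w = "\<lambda>n::int. 2 * of_real pi * \<i> * (of_int n + 1 / 2) :: complex"
  have sum: "((\<lambda>n. ?w n * theta_term 1 1 \<sigma> 0 n) has_sum theta' 1 1 \<sigma> 0) UNIV" if "Im \<sigma> > 0" for \<sigma>
    using theta_has_field_derivative(2)[OF that, of 1 1 0] by simp
  have "theta' 1 1 (2 ^ k * \<tau>) 0 = (\<Sum>\<^sub>\<infinity>n. ?w n * theta_term 1 1 (2 ^ k * \<tau>) 0 n)" for k
  proof -
    have "Im (2 ^ k * \<tau>) > 0"
      using assms by (rule Im_two_power_mult)
    then show ?thesis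
      by (intro infsumI[symmetric] sum)
  qed
  moreover have "(\<Sum>n\<in>{0, - 1}. ?w n * expi ((of_int n + 1 / 2) / 2)) = - 2 * of_real pi"
    by (simp add: expi_minus)
  ultimately show ?thesis
    using weighted_theta_tendsto[of 1 \<tau> ?w 1] assms has_sum_imp_summable[OF sum[OF assms]]
    by simp
qed

section \<open>Nonvanishing of the theta constants\<close>

text \<open>By \<open>theta_00_mult_theta_01\<close>, a zero at \<open>\<tau>\<close> is inherited by \<open>2\<tau>\<close>, \<open>4\<tau>\<close>, and so on, while the values along
  this sequence tend to 1.\<close>

lemma theta_01_nonzero:
  assumes "Im \<tau> > 0"
  shows "theta 0 1 \<tau> 0 \<noteq> 0"
proof
  assume zero: "theta 0 1 \<tau> 0 = 0"
  have "theta 0 1 (2 ^ k * \<tau>) 0 = 0" for k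
  proof (induction k)
    case (Suc k)
    then show ?case
      using theta_00_mult_theta_01[OF Im_two_power_mult[OF assms, of k]] by (simp add: mult.assoc)
  qed (use zero in simp)
  then show False
    using theta_0_tendsto[OF assms, of 1] by (simp add: LIMSEQ_const_iff)
qed

lemma theta_00_nonzero:
  assumes "Im \<tau> > 0"
  shows "theta 0 0 \<tau> 0 \<noteq> 0"
  using theta_00_mult_theta_01[OF assms] theta_01_nonzero[of "2 * \<tau>"] assms by auto

text \<open>The same descent, with \<open>theta_00_mult_theta_10\<close>, after division by the nonzero constant
  \<open>\<theta>[0;0](2\<tau>)\<close>.\<close>

lemma theta_10_nonzero:
  assumes "Im \<tau> > 0"
  shows "theta 1 0 \<tau> 0 \<noteq> 0"
proof
  assume zero: "theta 1 0 \<tau> 0 = 0"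
  have "theta 1 0 (2 ^ k * \<tau>) 0 = 0" for k
  proof (induction k)
    case (Suc k)
    then show ?case
      using theta_00_mult_theta_10[OF Im_two_power_mult[OF assms, of k]]
        theta_00_nonzero[OF Im_two_power_mult[OF assms, of "Suc k"]] by (simp add: mult.assoc)
  qed (use zero in simp)
  then show False
    using theta_10_tendsto[OF assms] by (simp add: LIMSEQ_const_iff)
qed

section \<open>Jacobi's derivative formula\<close>

lemma theta_01_even: "theta 0 1 \<tau> (- z) = theta 0 1 \<tau> z"
  using theta_minus[of 0 1 \<tau> z] theta_add_two_right[of 0 "-1" \<tau> z] by simp

lemma theta_11_odd: "theta 1 1 \<tau> (- z) = - theta 1 1 \<tau> z"
  using theta_minus[of 1 1 \<tau> z] theta_add_two_left[of "-1" "-1" \<tau> z]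
    theta_add_two_right[of 1 "-1" \<tau> z] by simp

lemma theta_11_zero: "theta 1 1 \<tau> 0 = 0"
  using theta_11_odd[of \<tau> 0] by simp

lemma theta_scaled_has_field_derivative:
  assumes "Im \<tau> > 0"
  shows "((\<lambda>z. theta \<epsilon> \<delta> \<tau> (c * z)) has_field_derivative c * theta' \<epsilon> \<delta> \<tau> 0) (at 0)"
proof -
  have "((\<lambda>z. theta \<epsilon> \<delta> \<tau> (c * z)) has_field_derivative theta' \<epsilon> \<delta> \<tau> (c * 0) * c) (at 0)"
    by (rule DERIV_chain'[OF _ theta_has_field_derivative(1)[OF assms]])
       (auto intro!: derivative_eq_intros)
  then show ?thesis
    by (simp add: mult.commute)
qed

lemma theta'_01_zero:
  assumes "Im \<tau> > 0"
  shows "theta' 0 1 \<tau> 0 = 0"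
proof -
  have "theta' 0 1 \<tau> 0 = -1 * theta' 0 1 \<tau> 0"
    by (rule DERIV_unique[OF theta_has_field_derivative(1)[OF assms]])
       (use theta_scaled_has_field_derivative[OF assms, of 0 1 "-1"] in \<open>simp add: theta_01_even\<close>)
  then show ?thesis
    by simp
qed

text \<open>The product formula at \<open>x = z + 1/2\<close>, \<open>y = z\<close>; its second product contains the factor
  \<open>\<theta>[1;1](2\<tau>,0) = 0\<close>.\<close>

lemma theta_11_mult_theta_10:
  assumes "Im \<tau> > 0"
  shows "theta 1 1 \<tau> z * theta 1 0 \<tau> z = theta 1 1 (2 * \<tau>) (2 * z) * theta 0 1 (2 * \<tau>) 0"
proof -
  have [simp]: "theta \<epsilon> 0 \<sigma> (w + 1 / 2) = theta \<epsilon> 1 \<sigma> w" for \<epsilon> \<sigma> w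
    using theta_shift_argument[of \<epsilon> 0 \<sigma> w 1] by simp
  have [simp]: "theta \<epsilon> 0 \<sigma> (1 / 2) = theta \<epsilon> 1 \<sigma> 0" for \<epsilon> \<sigma>
    using theta_shift_argument[of \<epsilon> 0 \<sigma> 0 1] by simp
  have "z + 1 / 2 + z = 2 * z + 1 / 2" "z + 1 / 2 - z = 1 / 2"
    by simp_all
  with theta_product[OF assms, of 1 "z + 1 / 2" z] show ?thesis
    by (simp only:) (simp add: theta_11_zero)
qed

lemma theta'_11_mult_theta_10:
  assumes "Im \<tau> > 0"
  shows "theta' 1 1 \<tau> 0 * theta 1 0 \<tau> 0 = 2 * theta' 1 1 (2 * \<tau>) 0 * theta 0 1 (2 * \<tau>) 0"
proof -
  have \<tau>: "Im (2 * \<tau>) > 0"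
    using assms by simp
  note D = theta_has_field_derivative(1)[OF assms, of _ _ 0]
  have "((\<lambda>z. theta 1 1 \<tau> z * theta 1 0 \<tau> z) has_field_derivative
      theta' 1 1 \<tau> 0 * theta 1 0 \<tau> 0) (at 0)"
    using DERIV_mult[OF D[of 1 1] D[of 1 0]] by (simp add: theta_11_zero)
  moreover have "((\<lambda>z. theta 1 1 \<tau> z * theta 1 0 \<tau> z) has_field_derivative
      2 * theta' 1 1 (2 * \<tau>) 0 * theta 0 1 (2 * \<tau>) 0) (at 0)"
    unfolding theta_11_mult_theta_10[OF assms]
    by (rule DERIV_cmult_right[OF theta_scaled_has_field_derivative[OF \<tau>]])
  ultimately show ?thesis
    by (rule DERIV_unique)
qed

text \<open>The three relations between constants at \<open>\<tau>\<close> and at \<open>2\<tau>\<close> make the quotient \<open>F\<close> of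
  \<open>\<theta>'[1;1]\<close> by the product of the three constants invariant under doubling, and its limit along \<open>2\<^sup>k\<tau>\<close> is \<open>-2\<pi> / 2\<close>.\<close>

theorem jacobi_derivative_formula:
  assumes "Im \<tau> > 0"
  shows "theta' 1 1 \<tau> 0 = - of_real pi * theta 0 0 \<tau> 0 * theta 0 1 \<tau> 0 * theta 1 0 \<tau> 0"
proof -
  define F where "F \<sigma> = theta' 1 1 \<sigma> 0 / (theta 0 0 \<sigma> 0 * theta 0 1 \<sigma> 0 * theta 1 0 \<sigma> 0)" for \<sigma>
  have doubling: "F (2 * \<sigma>) = F \<sigma>" if \<sigma>: "Im \<sigma> > 0" for \<sigma>
  proof -
    have \<sigma>2: "Im (2 * \<sigma>) > 0"
      using \<sigma> by simp
    note nz = theta_00_nonzero[OF \<sigma>] theta_01_nonzero[OF \<sigma>] theta_10_nonzero[OF \<sigma>]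
      theta_00_nonzero[OF \<sigma>2] theta_01_nonzero[OF \<sigma>2] theta_10_nonzero[OF \<sigma>2]
    have "F \<sigma> = (theta' 1 1 \<sigma> 0 * theta 1 0 \<sigma> 0)
        / ((theta 0 0 \<sigma> 0 * theta 0 1 \<sigma> 0) * (theta 1 0 \<sigma> 0)\<^sup>2)"
      using nz by (simp add: F_def power2_eq_square)
    also have "\<dots> = (2 * theta' 1 1 (2 * \<sigma>) 0 * theta 0 1 (2 * \<sigma>) 0)
        / ((theta 0 1 (2 * \<sigma>) 0)\<^sup>2 * (2 * theta 0 0 (2 * \<sigma>) 0 * theta 1 0 (2 * \<sigma>) 0))"
      by (simp only: theta'_11_mult_theta_10[OF \<sigma>] theta_00_mult_theta_01[OF \<sigma>]
          theta_00_mult_theta_10[OF \<sigma>])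
    also have "\<dots> = F (2 * \<sigma>)"
      using nz by (simp add: F_def power2_eq_square)
    finally show ?thesis ..
  qed
  have F: "F (2 ^ k * \<tau>) = F \<tau>" for k
    by (induction k) (use doubling[OF Im_two_power_mult[OF assms]] in \<open>simp_all add: mult.assoc\<close>)
  have "(\<lambda>k. (theta' 1 1 (2 ^ k * \<tau>) 0 / expi (2 ^ k * \<tau> / 8))
      / (theta 0 0 (2 ^ k * \<tau>) 0 * theta 0 1 (2 ^ k * \<tau>) 0
          * (theta 1 0 (2 ^ k * \<tau>) 0 / expi (2 ^ k * \<tau> / 8))))
      \<longlonglongrightarrow> (- 2 * of_real pi) / (1 * 1 * 2)"
    by (intro tendsto_divide tendsto_mult theta_0_tendsto theta_10_tendsto theta'_11_tendsto assms) simp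
  then have "(\<lambda>k. F (2 ^ k * \<tau>)) \<longlonglongrightarrow> - of_real pi"
    by (simp add: F_def)
  then have "F \<tau> = - of_real pi"
    unfolding F by (simp add: LIMSEQ_const_iff)
  then show ?thesis
    using theta_00_nonzero[OF assms] theta_01_nonzero[OF assms] theta_10_nonzero[OF assms]
    by (simp add: F_def field_simps)
qed

section \<open>Logarithmic derivatives at the quarter-integer characteristics\<close>

text \<open>The even part \<open>\<theta>[0;1](4\<tau>,2z)\<close> of the dissection carries the value at 0, and the odd part
  \<open>\<theta>[1;1](4\<tau>,2z)\<close> carries the derivative.\<close>

lemma theta'_0_half:
  assumes "Im \<tau> > 0"
  shows "theta' 0 (1/2) \<tau> 0 = - of_real pi * theta 0 (1/2) \<tau> 0 * (theta 1 0 (2 * \<tau>) 0)\<^sup>2"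
proof -
  have \<tau>: "Im (4 * \<tau>) > 0" "Im (2 * \<tau>) > 0"
    using assms by simp_all
  have dissect: "theta 0 (1/2) \<tau> z = theta 0 1 (4 * \<tau>) (2 * z) + theta 1 1 (4 * \<tau>) (2 * z)" for z
    using theta_dissection[OF assms, of 0 "1/2" z] by simp
  have "(theta 0 (1/2) \<tau> has_field_derivative 2 * theta' 0 1 (4 * \<tau>) 0 + 2 * theta' 1 1 (4 * \<tau>) 0)
      (at 0)"
    unfolding dissect[abs_def] by (intro DERIV_add theta_scaled_has_field_derivative \<tau>)
  then have "theta' 0 (1/2) \<tau> 0 = 2 * theta' 1 1 (4 * \<tau>) 0"
    using DERIV_unique[OF theta_has_field_derivative(1)[OF assms]] theta'_01_zero[OF \<tau>(1)] by simp
  moreover have "theta 0 (1/2) \<tau> 0 = theta 0 1 (4 * \<tau>) 0"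
    using dissect[of 0] by (simp add: theta_11_zero)
  moreover have "2 * theta 0 0 (4 * \<tau>) 0 * theta 1 0 (4 * \<tau>) 0 = (theta 1 0 (2 * \<tau>) 0)\<^sup>2"
    using theta_00_mult_theta_10[OF \<tau>(2)] by simp
  ultimately show ?thesis
    using jacobi_derivative_formula[OF \<tau>(1)] by (simp add: mult_ac)
qed

text \<open>Dissecting at \<open>\<sigma> = \<tau>/4\<close> shows that \<open>\<theta>[1/2;0](\<tau>,z)\<close> has \<open>\<theta>[1;0](\<sigma>,z/2)\<close> as twice its even part, and
  \<open>\<theta>[1;1](\<sigma>,z/2)\<close>, up to a factor \<open>\<i>\<close>, as twice its odd part.\<close>

lemma theta'_half_0:
  assumes "Im \<tau> > 0"
  shows "theta' (1/2) 0 \<tau> 0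
       = of_real pi * \<i> / 2 * ((theta 0 0 \<tau> 0)\<^sup>2 - (theta 1 0 \<tau> 0)\<^sup>2) * theta (1/2) 0 \<tau> 0"
proof -
  define \<sigma> where "\<sigma> = \<tau> / 4"
  have \<sigma>: "Im \<sigma> > 0" "Im (2 * \<sigma>) > 0" and \<tau>_eq: "\<tau> = 4 * \<sigma>"
    using assms by (simp_all add: \<sigma>_def)
  have refl: "theta (3/2) 0 \<tau> z = theta (1/2) 0 \<tau> (- z)" for z
    using theta_add_two_left[of "-1/2" 0 \<tau> z] theta_minus[of "1/2" 0 \<tau> z] by simp
  have split: "theta 1 1 \<sigma> z = \<i> * (theta (1/2) 0 \<tau> (2 * z) - theta (1/2) 0 \<tau> (- 2 * z))" for z
    using theta_dissection[OF \<sigma>(1), of 1 1 z] theta_add_two_right[of "1/2" 0 \<tau> "2 * z"]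
      theta_add_two_right[of "3/2" 0 \<tau> "2 * z"] refl[of "2 * z"]
    by (simp add: \<tau>_eq algebra_simps)
  have "(theta 1 1 \<sigma> has_field_derivative
      \<i> * (2 * theta' (1/2) 0 \<tau> 0 - (- 2) * theta' (1/2) 0 \<tau> 0)) (at 0)"
    unfolding split[abs_def]
    by (intro DERIV_cmult DERIV_diff theta_scaled_has_field_derivative assms)
  then have derivative: "theta' 1 1 \<sigma> 0 = 4 * \<i> * theta' (1/2) 0 \<tau> 0"
    using DERIV_unique[OF theta_has_field_derivative(1)[OF \<sigma>(1)]] by simp
  have at_zero: "theta 1 0 \<sigma> 0 = 2 * theta (1/2) 0 \<tau> 0"
    using theta_dissection[OF \<sigma>(1), of 1 0 0] refl[of 0] by (simp add: \<tau>_eq)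
  have squares: "theta 0 0 \<sigma> 0 * theta 0 1 \<sigma> 0 = (theta 0 0 \<tau> 0)\<^sup>2 - (theta 1 0 \<tau> 0)\<^sup>2"
    using theta_00_mult_theta_01[OF \<sigma>(1)] theta_01_square[OF \<sigma>(2)] by (simp add: \<tau>_eq)
  have "theta' (1/2) 0 \<tau> 0 = - \<i> / 4 * theta' 1 1 \<sigma> 0"
    by (simp add: derivative)
  also have "\<dots> = of_real pi * \<i> / 4 * (theta 0 0 \<sigma> 0 * theta 0 1 \<sigma> 0) * theta 1 0 \<sigma> 0"
    by (simp add: jacobi_derivative_formula[OF \<sigma>(1)])
  also have "\<dots> = of_real pi * \<i> / 2 * ((theta 0 0 \<tau> 0)\<^sup>2 - (theta 1 0 \<tau> 0)\<^sup>2) * theta (1/2) 0 \<tau> 0"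
    unfolding at_zero squares by simp
  finally show ?thesis .
qed

text \<open>Proportional functions have the same logarithmic derivative. Stated without a quotient, this
  also covers a value \<open>g z = 0\<close>.\<close>

lemma deriv_eq_mult_transfer:
  fixes f g :: "complex \<Rightarrow> complex"
  assumes "\<And>w. f w = c * g w" "c \<noteq> 0" "g field_differentiable at z" "deriv f z = a * f z"
  shows "deriv g z = a * g z"
proof -
  have "f = (\<lambda>w. c * g w)"
    using assms(1) by blast
  then have "deriv f z = c * deriv g z"
    using assms(3) by simp
  then have "c * deriv g z = a * (c * g z)"
    using assms(4) unfolding assms(1) by metis
  then have "c * deriv g z = c * (a * g z)"
    by (simp only: mult_ac)
  then show ?thesis
    using assms(2) by (metis mult_left_cancel)
qed

lemma theta_field_differentiable:
  "Im \<tau> > 0 \<Longrightarrow> theta \<epsilon> \<delta> \<tau> field_differentiable at z"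
  using theta_has_field_derivative(1) field_differentiable_def by blast

lemma theta'_translate:
  assumes "Im \<tau> > 0" "theta' \<epsilon> \<delta> (\<tau> + 1) z = a * theta \<epsilon> \<delta> (\<tau> + 1) z"
  shows "theta' \<epsilon> (\<delta> + 1 + \<epsilon>) \<tau> z = a * theta \<epsilon> (\<delta> + 1 + \<epsilon>) \<tau> z"
  unfolding theta'_def
  by (rule deriv_eq_mult_transfer[OF theta_translate expi_nonzero theta_field_differentiable])
     (use assms in \<open>simp_all only: theta'_def\<close>)

lemma theta'_add_two_right:
  assumes "Im \<tau> > 0" "theta' \<epsilon> (\<delta> + 2) \<tau> z = a * theta \<epsilon> (\<delta> + 2) \<tau> z"
  shows "theta' \<epsilon> \<delta> \<tau> z = a * theta \<epsilon> \<delta> \<tau> z"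
  unfolding theta'_def
  by (rule deriv_eq_mult_transfer[OF theta_add_two_right expi_nonzero theta_field_differentiable])
     (use assms in \<open>simp_all only: theta'_def\<close>)

lemma theta'_half_three_halves:
  assumes "Im \<tau> > 0"
  shows "theta' (1/2) (3/2) \<tau> 0
       = of_real pi * \<i> / 2 * ((theta 0 1 \<tau> 0)\<^sup>2 - \<i> * (theta 1 0 \<tau> 0)\<^sup>2) * theta (1/2) (3/2) \<tau> 0"
proof -
  have "Im (\<tau> + 1) > 0"
    using assms by simp
  from theta'_translate[OF assms theta'_half_0[OF this], unfolded theta_00_translate theta_10_square_translate]
  show ?thesis
    by simp
qed

text \<open>Here \<open>\<delta> = 3\<close> is reached from \<open>3/2\<close> by a further translation; it agrees with \<open>\<delta> = 1\<close> modulo 2.\<close>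

lemma theta'_half_3:
  assumes "Im \<tau> > 0"
  shows "theta' (1/2) 3 \<tau> 0
       = of_real pi * \<i> / 2 * ((theta 0 0 \<tau> 0)\<^sup>2 + (theta 1 0 \<tau> 0)\<^sup>2) * theta (1/2) 3 \<tau> 0"
proof -
  have "Im (\<tau> + 1) > 0"
    using assms by simp
  note theta'_translate[OF assms theta'_half_three_halves[OF this],
      unfolded theta_01_translate theta_10_square_translate]
  moreover have "x - \<i> * (\<i> * y) = x + y" for x y
    unfolding mult.assoc[symmetric] by simp
  ultimately show ?thesis
    by simp
qed

lemma theta'_half_1:
  assumes "Im \<tau> > 0"
  shows "theta' (1/2) 1 \<tau> 0
       = of_real pi * \<i> / 2 * ((theta 0 0 \<tau> 0)\<^sup>2 + (theta 1 0 \<tau> 0)\<^sup>2) * theta (1/2) 1 \<tau> 0"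
  by (rule theta'_add_two_right[OF assms]) (use theta'_half_3[OF assms] in simp)

text \<open>The translation takes \<open>\<delta> = 1\<close> to \<open>5/2\<close>, which is \<open>1/2\<close> modulo 2.\<close>

lemma theta'_half_half:
  assumes "Im \<tau> > 0"
  shows "theta' (1/2) (1/2) \<tau> 0
       = of_real pi * \<i> / 2 * ((theta 0 1 \<tau> 0)\<^sup>2 + \<i> * (theta 1 0 \<tau> 0)\<^sup>2) * theta (1/2) (1/2) \<tau> 0"
proof -
  have \<tau>1: "Im (\<tau> + 1) > 0"
    using assms by simp
  have "theta' (1/2) (1/2 + 2) \<tau> 0
      = of_real pi * \<i> / 2 * ((theta 0 1 \<tau> 0)\<^sup>2 + \<i> * (theta 1 0 \<tau> 0)\<^sup>2) * theta (1/2) (1/2 + 2) \<tau> 0"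
    using theta'_translate[OF assms theta'_half_1[OF \<tau>1],
        unfolded theta_00_translate theta_10_square_translate]
    by simp
  then show ?thesis
    by (rule theta'_add_two_right[OF assms])
qed

theorem theorem2p1:
  fixes \<tau> :: complex
  assumes "Im \<tau> > 0"
  shows
    "(theta' 0 (1/2) \<tau> 0
       = - of_real pi * theta 0 (1/2) \<tau> 0 * ((theta 0 0 \<tau> 0)\<^sup>2 - (theta 0 0 (2 * \<tau>) 0)\<^sup>2))
     \<and> (- of_real pi * theta 0 (1/2) \<tau> 0 * ((theta 0 0 \<tau> 0)\<^sup>2 - (theta 0 0 (2 * \<tau>) 0)\<^sup>2)
       = - of_real pi * theta 0 (1/2) \<tau> 0 * (theta 1 0 (2 * \<tau>) 0)\<^sup>2)
     \<and> (theta' (1/2) 1 \<tau> 0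
       = (of_real pi * \<i> / 2) * theta (1/2) 1 \<tau> 0 * (theta 0 0 (\<tau> / 2) 0)\<^sup>2)
     \<and> ((of_real pi * \<i> / 2) * theta (1/2) 1 \<tau> 0 * (theta 0 0 (\<tau> / 2) 0)\<^sup>2
       = (of_real pi * \<i> / 2) * theta (1/2) 1 \<tau> 0
           * ((theta 0 0 \<tau> 0)\<^sup>2 + (theta 1 0 \<tau> 0)\<^sup>2))
     \<and> (theta' (1/2) 0 \<tau> 0
       = (of_real pi * \<i> / 2) * theta (1/2) 0 \<tau> 0
           * ((theta 0 0 \<tau> 0)\<^sup>2 - (theta 1 0 \<tau> 0)\<^sup>2))
     \<and> (theta' (1/2) (1/2) \<tau> 0
       = (of_real pi * \<i> / 2) * theta (1/2) (1/2) \<tau> 0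
           * ((theta 0 0 (2 * \<tau>) 0)\<^sup>2 - (theta 1 0 (2 * \<tau>) 0)\<^sup>2 + \<i> * (theta 1 0 \<tau> 0)\<^sup>2))
     \<and> (theta' (1/2) (3/2) \<tau> 0
       = (of_real pi * \<i> / 2) * theta (1/2) (3/2) \<tau> 0
           * ((theta 0 0 (2 * \<tau>) 0)\<^sup>2 - (theta 1 0 (2 * \<tau>) 0)\<^sup>2 - \<i> * (theta 1 0 \<tau> 0)\<^sup>2))"
proof -
  have first: "(theta 0 0 \<tau> 0)\<^sup>2 - (theta 0 0 (2 * \<tau>) 0)\<^sup>2 = (theta 1 0 (2 * \<tau>) 0)\<^sup>2"
    using theta_00_square[OF assms] by simp
  have half: "(theta 0 0 (\<tau> / 2) 0)\<^sup>2 = (theta 0 0 \<tau> 0)\<^sup>2 + (theta 1 0 \<tau> 0)\<^sup>2"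
    using theta_00_square[of "\<tau> / 2"] assms by simp
  show ?thesis
    unfolding first half theta'_0_half[OF assms] theta'_half_0[OF assms] theta'_half_1[OF assms]
      theta'_half_half[OF assms] theta'_half_three_halves[OF assms] theta_01_square[OF assms]
    by (simp only: mult_ac simp_thms)
qed

end
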